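(* Let $E=(e_X,e_Y,R)$ be an extension polarity extending the poset $P$. The following are equivalent: (1) $E$ is 2-coherent; (2) $\preceq_1$ is a 2-preorder for $E$; (3) there exists a 2-preorder for $E$. Moreover, the set of 2-preorders for $E$ is closed under non-empty intersections and, if it is non-empty, has $\preceq_1$ as its smallest member; and in this case ${\le_X}=Z_X$ and ${\le_Y}=Z_Y$.
   Context: An extension polarity is a triple $(e_X,e_Y,R)$ where $P$ is a poset, $X,Y$ are disjoint posets, $e_X:P\to X$ and $e_Y:P\to Y$ are order embeddings, and $R\subseteq X\times Y$. Coherence conditions: (C1) for all $x_1,x_2\in X$, $y\in Y$: if $x_1\le_X x_2$ and $x_2\mathrel{R}y$ then $x_1\mathrel{R}y$. (C2) for all $y_1,y_2\in Y$, $x\in X$: if $y_1\le_Y y_2$ and $x\mathrel{R}y_1$ then $x\mathrel{R}y_2$. (C3) for all $p\in P$: $e_X(p)\mathrel{R}e_Y(p)$. (C4) for all $p,x,y$: if $x\mathrel{R}e_Y(p)$ and $e_X(p)\mathrel{R}y$ then $x\mathrel{R}y$. (C5) for all $x_1,x_2\in X$, $p\in P$: if $x_1\mathrel{R}e_Y(p)$ and $e_X(p)\le_X x_2$ then $x_1\le_X x_2$. (C6) for all $y_1,y_2\in Y$, $p\in P$: if $y_1\le_Y e_Y(p)$ and $e_X(p)\mathrel{R}y_2$ then $y_1\le_Y y_2$. $E$ is 2-coherent if it satisfies (C1)–(C6). For a preorder $\preceq$ on $X\cup Y$, let $X\uplus_\preceq Y$ be the quotient poset (identify $z_1,z_2$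 when $z_1\preceq z_2\preceq z_1$) and $\iota_X,\iota_Y$ the inclusions composed with the quotient map. A 0-preorder for $E$ is a preorder $\preceq$ on $X\cup Y$ with: $x\preceq y\iff x\mathrel{R}y$ for $x\in X,y\in Y$; ${\le_X}\subseteq{\preceq}$; ${\le_Y}\subseteq{\preceq}$. A 1-preorder is a 0-preorder with $\iota_X\circ e_X=\iota_Y\circ e_Y$. A 2-preorder is a 1-preorder for which $\iota_X$ and $\iota_Y$ are order embeddings. $\preceq_1$ is the union of $R$ with $Z_X=\{(x_1,x_2)\in X^2:\exists p\in P\,(x_1\mathrel{R}e_Y(p)\text{ and }e_X(p)\le_X x_2)\}\cup{\le_X}$, $Z_Y=\{(y_1,y_2)\in Y^2:\exists p\in P\,(y_1\le_Y e_Y(p)\text{ and }e_X(p)\mathrel{R}y_2)\}\cup{\le_Y}$, $Z_{YX}=\{(y,x)\in Y\times X:\exists p,q\in P\,(y\le_Y e_Y(p),\ e_X(p)\mathrel{R}e_Y(q),\ e_X(q)\le_X x)\}$. *)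

theory Defs
  imports Main
begin

definition order_embedding ::
    "'a set \<Rightarrow> 'a rel \<Rightarrow> 'b set \<Rightarrow> 'b rel \<Rightarrow> ('a \<Rightarrow> 'b) \<Rightarrow> bool" where
  "order_embedding A r B s f \<longleftrightarrow>
     f ` A \<subseteq> B \<and> (\<forall>a\<in>A. \<forall>b\<in>A. (a, b) \<in> r \<longleftrightarrow> (f a, f b) \<in> s)"

text \<open>Posets are given by carrier sets (possibly empty) and order relations. The carriers
  \<open>X\<close> and \<open>Y\<close> are subsets of one type, so that \<open>X \<union> Y\<close> makes sense literally.\<close>

record ('p, 'a) polarity =
  Pc :: "'p set"
  leP :: "'p rel"
  Xc :: "'a set"
  leX :: "'a rel"
  Yc :: "'a set"
  leY :: "'a rel"
  eX :: "'p \<Rightarrow> 'a"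
  eY :: "'p \<Rightarrow> 'a"
  Rel :: "'a rel"

definition extension_polarity :: "('p, 'a) polarity \<Rightarrow> bool" where
  "extension_polarity E \<longleftrightarrow>
     partial_order_on (Pc E) (leP E) \<and>
     partial_order_on (Xc E) (leX E) \<and>
     partial_order_on (Yc E) (leY E) \<and>
     Xc E \<inter> Yc E = {} \<and>
     order_embedding (Pc E) (leP E) (Xc E) (leX E) (eX E) \<and>
     order_embedding (Pc E) (leP E) (Yc E) (leY E) (eY E) \<and>
     Rel E \<subseteq> Xc E \<times> Yc E"

definition C1 :: "('p, 'a) polarity \<Rightarrow> bool" where
  "C1 E \<longleftrightarrow> (\<forall>x1\<in>Xc E. \<forall>x2\<in>Xc E. \<forall>y\<in>Yc E.
     (x1, x2) \<in> leX E \<and> (x2, y) \<in> Rel E \<longrightarrow> (x1, y) \<in> Rel E)"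

definition C2 :: "('p, 'a) polarity \<Rightarrow> bool" where
  "C2 E \<longleftrightarrow> (\<forall>y1\<in>Yc E. \<forall>y2\<in>Yc E. \<forall>x\<in>Xc E.
     (y1, y2) \<in> leY E \<and> (x, y1) \<in> Rel E \<longrightarrow> (x, y2) \<in> Rel E)"

definition C3 :: "('p, 'a) polarity \<Rightarrow> bool" where
  "C3 E \<longleftrightarrow> (\<forall>p\<in>Pc E. (eX E p, eY E p) \<in> Rel E)"

definition C4 :: "('p, 'a) polarity \<Rightarrow> bool" where
  "C4 E \<longleftrightarrow> (\<forall>p\<in>Pc E. \<forall>x\<in>Xc E. \<forall>y\<in>Yc E.
     (x, eY E p) \<in> Rel E \<and> (eX E p, y) \<in> Rel E \<longrightarrow> (x, y) \<in> Rel E)"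

definition C5 :: "('p, 'a) polarity \<Rightarrow> bool" where
  "C5 E \<longleftrightarrow> (\<forall>x1\<in>Xc E. \<forall>x2\<in>Xc E. \<forall>p\<in>Pc E.
     (x1, eY E p) \<in> Rel E \<and> (eX E p, x2) \<in> leX E \<longrightarrow> (x1, x2) \<in> leX E)"

definition C6 :: "('p, 'a) polarity \<Rightarrow> bool" where
  "C6 E \<longleftrightarrow> (\<forall>y1\<in>Yc E. \<forall>y2\<in>Yc E. \<forall>p\<in>Pc E.
     (y1, eY E p) \<in> leY E \<and> (eX E p, y2) \<in> Rel E \<longrightarrow> (y1, y2) \<in> leY E)"

definition two_coherent :: "('p, 'a) polarity \<Rightarrow> bool" where
  "two_coherent E \<longleftrightarrow> C1 E \<and> C2 E \<and> C3 E \<and> C4 E \<and> C5 E \<and> C6 E"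

definition quot_carrier :: "('p, 'a) polarity \<Rightarrow> 'a rel \<Rightarrow> 'a set set" where
  "quot_carrier E r = (Xc E \<union> Yc E) // (r \<inter> r\<inverse>)"

definition quot_le :: "('p, 'a) polarity \<Rightarrow> 'a rel \<Rightarrow> 'a set rel" where
  "quot_le E r = {(A, B). A \<in> quot_carrier E r \<and> B \<in> quot_carrier E r \<and>
     (\<exists>a\<in>A. \<exists>b\<in>B. (a, b) \<in> r)}"

text \<open>The quotient map; since \<open>X\<close> and \<open>Y\<close> are literally subsets of \<open>X \<union> Y\<close>, its
  restrictions to \<open>X\<close> and \<open>Y\<close> are \<open>\<iota>\<^sub>X\<close> and \<open>\<iota>\<^sub>Y\<close>.\<close>

definition quot_map :: "'a rel \<Rightarrow> 'a \<Rightarrow> 'a set" where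
  "quot_map r z = (r \<inter> r\<inverse>) `` {z}"

definition zero_preorder :: "('p, 'a) polarity \<Rightarrow> 'a rel \<Rightarrow> bool" where
  "zero_preorder E r \<longleftrightarrow>
     preorder_on (Xc E \<union> Yc E) r \<and>
     (\<forall>x\<in>Xc E. \<forall>y\<in>Yc E. (x, y) \<in> r \<longleftrightarrow> (x, y) \<in> Rel E) \<and>
     leX E \<subseteq> r \<and> leY E \<subseteq> r"

definition one_preorder :: "('p, 'a) polarity \<Rightarrow> 'a rel \<Rightarrow> bool" where
  "one_preorder E r \<longleftrightarrow>
     zero_preorder E r \<and>
     (\<forall>p\<in>Pc E. (quot_map r \<circ> eX E) p = (quot_map r \<circ> eY E) p)"

definition two_preorder :: "('p, 'a) polarity \<Rightarrow> 'a rel \<Rightarrow> bool" where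
  "two_preorder E r \<longleftrightarrow>
     one_preorder E r \<and>
     order_embedding (Xc E) (leX E) (quot_carrier E r) (quot_le E r) (quot_map r) \<and>
     order_embedding (Yc E) (leY E) (quot_carrier E r) (quot_le E r) (quot_map r)"

definition ZX :: "('p, 'a) polarity \<Rightarrow> 'a rel" where
  "ZX E = {(x1, x2). x1 \<in> Xc E \<and> x2 \<in> Xc E \<and>
     (\<exists>p\<in>Pc E. (x1, eY E p) \<in> Rel E \<and> (eX E p, x2) \<in> leX E)} \<union> leX E"

definition ZY :: "('p, 'a) polarity \<Rightarrow> 'a rel" where
  "ZY E = {(y1, y2). y1 \<in> Yc E \<and> y2 \<in> Yc E \<and>
     (\<exists>p\<in>Pc E. (y1, eY E p) \<in> leY E \<and> (eX E p, y2) \<in> Rel E)} \<union> leY E"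

definition ZYX :: "('p, 'a) polarity \<Rightarrow> 'a rel" where
  "ZYX E = {(y, x). y \<in> Yc E \<and> x \<in> Xc E \<and>
     (\<exists>p\<in>Pc E. \<exists>q\<in>Pc E. (y, eY E p) \<in> leY E \<and> (eX E p, eY E q) \<in> Rel E \<and>
        (eX E q, x) \<in> leX E)}"

definition prec1 :: "('p, 'a) polarity \<Rightarrow> 'a rel" where
  "prec1 E = Rel E \<union> ZX E \<union> ZY E \<union> ZYX E"

end

(* A relation r is a 2-preorder exactly when it is a preorder on the union of X and Y that
   restricts to R on X x Y, to the given orders on X and on Y, and relates the two images of
   each p in both directions. This description is stable under intersections. Transitivity of
   such an r yields (C1)-(C6) and forces every pair of the relation prec1 into r; conversely,
   under (C1)-(C6) the sets ZX and ZY collapse to the given orders, and transitivity of prec1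
   is a case distinction. *)

theory Submission
  imports Defs
begin

lemma partial_order_onD:
  assumes "partial_order_on A r"
  shows "r \<subseteq> A \<times> A" "a \<in> A \<Longrightarrow> (a, a) \<in> r" "trans r"
  using assms by (simp_all add: partial_order_on_def preorder_on_def refl_on_def)

lemma quot_map_eq_iff:
  assumes "preorder_on A r" "a \<in> A" "b \<in> A"
  shows "quot_map r a = quot_map r b \<longleftrightarrow> (a, b) \<in> r \<and> (b, a) \<in> r"
proof -
  have t: "trans r" and "refl_on A r"
    using assms(1) by (auto simp: preorder_on_def)
  then have "(a, a) \<in> r" "(b, b) \<in> r"
    using assms by (auto elim: refl_onD)
  then show ?thesis
    unfolding quot_map_def using transD[OF t] by blast
qed

text \<open>\<open>quot_le\<close> asks only for some related representatives. By transitivity the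
  relation passes between any two representatives of the same classes, so it may be tested at
  \<open>a\<close> and \<open>b\<close> themselves.\<close>

lemma quot_map_le_iff:
  assumes "preorder_on (Xc E \<union> Yc E) r" "a \<in> Xc E \<union> Yc E" "b \<in> Xc E \<union> Yc E"
  shows "(quot_map r a, quot_map r b) \<in> quot_le E r \<longleftrightarrow> (a, b) \<in> r"
proof -
  have t: "trans r" and "refl_on (Xc E \<union> Yc E) r"
    using assms(1) by (auto simp: preorder_on_def)
  then have r: "(a, a) \<in> r" "(b, b) \<in> r"
    using assms by (auto elim: refl_onD)
  have "quot_map r a \<in> quot_carrier E r" "quot_map r b \<in> quot_carrier E r"
    using assms by (auto simp: quot_map_def quot_carrier_def quotientI)
  then show ?thesis
    unfolding quot_le_def quot_map_def using r transD[OF t] by blast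
qed

text \<open>Being an embedding only compares \<open>r\<close> and \<open>s\<close> on pairs from
  \<open>A\<close>; as \<open>s\<close> has no other pairs, this agreement is an equation of
  sets.\<close>

lemma order_embedding_quot_map_iff:
  assumes "preorder_on (Xc E \<union> Yc E) r" "A \<subseteq> Xc E \<union> Yc E" "s \<subseteq> A \<times> A"
  shows "order_embedding A s (quot_carrier E r) (quot_le E r) (quot_map r)
    \<longleftrightarrow> r \<inter> A \<times> A = s"
proof -
  have "quot_map r ` A \<subseteq> quot_carrier E r"
    using assms(2) by (auto simp: quot_map_def quot_carrier_def intro!: quotientI)
  moreover have "(quot_map r a, quot_map r b) \<in> quot_le E r \<longleftrightarrow> (a, b) \<in> r"
    if "a \<in> A" "b \<in> A" for a b
    using that assms(2) by (intro quot_map_le_iff[OF assms(1)]) auto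
  ultimately show ?thesis
    using assms(3) by (auto simp: order_embedding_def)
qed

text \<open>This removes the quotient from all later arguments. The equations for the restrictions
  of \<open>r\<close> absorb the inclusions of \<open>leX E\<close> and \<open>leY E\<close> in
  \<open>r\<close>, and their right-hand sides do not mention \<open>r\<close>.\<close>

lemma two_preorder_iff:
  assumes "extension_polarity E"
  shows "two_preorder E r \<longleftrightarrow>
    preorder_on (Xc E \<union> Yc E) r \<and> r \<inter> Xc E \<times> Yc E = Rel E \<and>
    r \<inter> Xc E \<times> Xc E = leX E \<and> r \<inter> Yc E \<times> Yc E = leY E \<and>
    (\<forall>p\<in>Pc E. (eX E p, eY E p) \<in> r \<and> (eY E p, eX E p) \<in> r)"
\<comment> \<open>The facts about the quotient map need a preorder; for any other \<open>r\<close>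
  both sides are false.\<close>
proof (cases "preorder_on (Xc E \<union> Yc E) r")
  case True
  have sub: "leX E \<subseteq> Xc E \<times> Xc E" "leY E \<subseteq> Yc E \<times> Yc E" "Rel E \<subseteq> Xc E \<times> Yc E"
    using assms by (auto simp: extension_polarity_def dest!: partial_order_onD(1))
  have e: "eX E p \<in> Xc E" "eY E p \<in> Yc E" if "p \<in> Pc E" for p
    using assms that by (auto simp: extension_polarity_def order_embedding_def)
  have q: "quot_map r (eX E p) = quot_map r (eY E p)
      \<longleftrightarrow> (eX E p, eY E p) \<in> r \<and> (eY E p, eX E p) \<in> r" if "p \<in> Pc E" for p
    using e[OF that] by (intro quot_map_eq_iff[OF True]) auto
  have rel: "(\<forall>x\<in>Xc E. \<forall>y\<in>Yc E. (x, y) \<in> r \<longleftrightarrow> (x, y) \<in> Rel E)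
      \<longleftrightarrow> r \<inter> Xc E \<times> Yc E = Rel E"
    using sub(3) by auto
  have emb: "order_embedding (Xc E) (leX E) (quot_carrier E r) (quot_le E r) (quot_map r)
      \<longleftrightarrow> r \<inter> Xc E \<times> Xc E = leX E"
    "order_embedding (Yc E) (leY E) (quot_carrier E r) (quot_le E r) (quot_map r)
      \<longleftrightarrow> r \<inter> Yc E \<times> Yc E = leY E"
    using sub by (auto intro!: order_embedding_quot_map_iff[OF True])
  show ?thesis
    unfolding two_preorder_def one_preorder_def zero_preorder_def rel emb
    using True q by auto
next
  case False
  then show ?thesis
    by (simp add: two_preorder_def one_preorder_def zero_preorder_def)
qed

text \<open>A member of \<open>S\<close> is needed to bound the intersection by
  \<open>A \<times> A\<close>: the intersection of the empty family is the universal
  relation.\<close>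

lemma preorder_on_Inter:
  assumes "S \<noteq> {}" "\<And>r. r \<in> S \<Longrightarrow> preorder_on A r"
  shows "preorder_on A (\<Inter>S)"
proof -
  have "trans (\<Inter>S)"
    using assms(2) by (auto simp: preorder_on_def intro: trans_INTER[of S "\<lambda>r. r", simplified])
  moreover have "refl_on A (\<Inter>S)" "\<Inter>S \<subseteq> A \<times> A"
    using assms by (fastforce simp: preorder_on_def refl_on_def)+
  ultimately show ?thesis
    by (simp add: preorder_on_def)
qed

lemma two_preorder_Inter:
  assumes "extension_polarity E" "S \<noteq> {}" "\<And>r. r \<in> S \<Longrightarrow> two_preorder E r"
  shows "two_preorder E (\<Inter>S)"
proof -
  note S = assms(3)[unfolded two_preorder_iff[OF assms(1)]]
  have restr: "\<Inter>S \<inter> A = B" if "\<And>r. r \<in> S \<Longrightarrow> r \<inter> A = B" for A B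
    using assms(2) that by blast
  show ?thesis
    unfolding two_preorder_iff[OF assms(1)]
    using S preorder_on_Inter[OF assms(2)] by (simp add: restr)
qed

text \<open>In \<open>r\<close> each \<open>eY E p\<close> lies below \<open>eX E p\<close>, so a
  chain may stop at \<open>eY E p\<close> and resume at \<open>eX E p\<close>. New pairs of
  \<open>ZX\<close> and \<open>ZY\<close> come from one such jump, pairs of \<open>ZYX\<close> from
  two.\<close>

lemma prec1_least:
  assumes E: "extension_polarity E" and r: "two_preorder E r"
  shows "prec1 E \<subseteq> r"
proof -
  note r' = r[unfolded two_preorder_iff[OF E]]
  then have t: "(a, b) \<in> r \<Longrightarrow> (b, c) \<in> r \<Longrightarrow> (a, c) \<in> r" for a b c
    by (meson preorder_on_def transD)
  have le: "Rel E \<subseteq> r" "leX E \<subseteq> r" "leY E \<subseteq> r"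
    using r' by blast+
  have e: "(eY E p, eX E p) \<in> r" if "p \<in> Pc E" for p
    using r' that by blast
  have via: "(a, c) \<in> r" if "p \<in> Pc E" "(a, eY E p) \<in> r" "(eX E p, c) \<in> r" for a p c
    using t[OF that(2) t[OF e[OF that(1)] that(3)]] .
  have "ZX E \<subseteq> r" "ZY E \<subseteq> r"
    unfolding ZX_def ZY_def using le by (auto intro: via[OF _ subsetD subsetD])
  moreover have "ZYX E \<subseteq> r"
    unfolding ZYX_def
  proof clarify
    fix y x p q
    assume "p \<in> Pc E" "q \<in> Pc E" "(y, eY E p) \<in> leY E" "(eX E p, eY E q) \<in> Rel E"
      "(eX E q, x) \<in> leX E"
    then show "(y, x) \<in> r"
      using le by (meson subsetD via)
  qed
  ultimately show ?thesis
    using le by (simp add: prec1_def)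
qed

text \<open>(C5) and (C6) say exactly that the existential parts of \<open>ZX\<close> and
  \<open>ZY\<close> add no new pairs.\<close>

lemma ZX_ZY_eq:
  assumes "two_coherent E"
  shows "ZX E = leX E" "ZY E = leY E"
proof -
  have "(x1, x2) \<in> leX E" if "p \<in> Pc E" "x1 \<in> Xc E" "x2 \<in> Xc E"
      "(x1, eY E p) \<in> Rel E" "(eX E p, x2) \<in> leX E" for x1 x2 p
    using assms that unfolding two_coherent_def C5_def by blast
  then show "ZX E = leX E"
    by (auto simp: ZX_def)
  have "(y1, y2) \<in> leY E" if "p \<in> Pc E" "y1 \<in> Yc E" "y2 \<in> Yc E"
      "(y1, eY E p) \<in> leY E" "(eX E p, y2) \<in> Rel E" for y1 y2 p
    using assms that unfolding two_coherent_def C6_def by blast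
  then show "ZY E = leY E"
    by (auto simp: ZY_def)
qed

lemma two_coherent_if_two_preorder:
  assumes E: "extension_polarity E" and r: "two_preorder E r"
  shows "two_coherent E"
proof -
  note r' = r[unfolded two_preorder_iff[OF E]]
  then have t: "(a, b) \<in> r \<Longrightarrow> (b, c) \<in> r \<Longrightarrow> (a, c) \<in> r" for a b c
    by (meson preorder_on_def transD)
  have R: "(x, y) \<in> Rel E \<longleftrightarrow> (x, y) \<in> r" if "x \<in> Xc E" "y \<in> Yc E" for x y
    using r' that by blast
  have X: "(x, y) \<in> leX E \<longleftrightarrow> (x, y) \<in> r" if "x \<in> Xc E" "y \<in> Xc E" for x y
    using r' that by blast
  have Y: "(x, y) \<in> leY E \<longleftrightarrow> (x, y) \<in> r" if "x \<in> Yc E" "y \<in> Yc E" for x y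
    using r' that by blast
  have e: "eX E p \<in> Xc E" "eY E p \<in> Yc E" "(eX E p, eY E p) \<in> r" "(eY E p, eX E p) \<in> r"
    if "p \<in> Pc E" for p
    using E r' that by (auto simp: extension_polarity_def order_embedding_def)
  show ?thesis
    \<comment> \<open>Once every atom is rewritten to membership in \<open>r\<close>, (C3) is
      immediate, (C1) and (C2) are single compositions, and (C4) to (C6) compose through the pair
      \<open>(eY E p, eX E p)\<close>.\<close>
    unfolding two_coherent_def C1_def C2_def C3_def C4_def C5_def C6_def
    by (auto simp: R X Y e) (meson t e)+
qed

lemma two_preorder_prec1:
  assumes E: "extension_polarity E" and coh: "two_coherent E"
  shows "two_preorder E (prec1 E)"
proof -
  have po: "partial_order_on (Xc E) (leX E)" "partial_order_on (Yc E) (leY E)"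
    and "Rel E \<subseteq> Xc E \<times> Yc E"
    using E by (simp_all add: extension_polarity_def)
  then have sub: "leX E \<subseteq> Xc E \<times> Xc E" "leY E \<subseteq> Yc E \<times> Yc E" "Rel E \<subseteq> Xc E \<times> Yc E"
    by (simp_all add: partial_order_onD(1))
  have rX: "\<And>x. x \<in> Xc E \<Longrightarrow> (x, x) \<in> leX E"
    and rY: "\<And>y. y \<in> Yc E \<Longrightarrow> (y, y) \<in> leY E"
    and "trans (leX E)" "trans (leY E)"
    using partial_order_onD(2,3)[OF po(1)] partial_order_onD(2,3)[OF po(2)] by simp_all
  note tX = transD[OF \<open>trans (leX E)\<close>] and tY = transD[OF \<open>trans (leY E)\<close>]
  have disj: "Xc E \<inter> Yc E = {}"
    and e: "\<And>p. p \<in> Pc E \<Longrightarrow> eX E p \<in> Xc E" "\<And>p. p \<in> Pc E \<Longrightarrow> eY E p \<in> Yc E"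
    using E by (auto simp: extension_polarity_def order_embedding_def)
  \<comment> \<open>The coherence conditions are restated so that \<open>sub\<close> supplies their
    carrier premises.\<close>
  have c1: "(a, c) \<in> Rel E" if "(a, b) \<in> leX E" "(b, c) \<in> Rel E" for a b c
    using coh sub that unfolding two_coherent_def C1_def by blast
  have c2: "(a, c) \<in> Rel E" if "(a, b) \<in> Rel E" "(b, c) \<in> leY E" for a b c
    using coh sub that unfolding two_coherent_def C2_def by blast
  have c3: "(eX E p, eY E p) \<in> Rel E" if "p \<in> Pc E" for p
    using coh that unfolding two_coherent_def C3_def by blast
  have c4: "(a, c) \<in> Rel E" if "p \<in> Pc E" "(a, eY E p) \<in> Rel E" "(eX E p, c) \<in> Rel E" for a p c
    using coh sub that unfolding two_coherent_def C4_def by blast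
  have c5: "(a, c) \<in> leX E" if "p \<in> Pc E" "(a, eY E p) \<in> Rel E" "(eX E p, c) \<in> leX E" for a p c
    using coh sub that unfolding two_coherent_def C5_def by blast
  have c6: "(a, c) \<in> leY E" if "p \<in> Pc E" "(a, eY E p) \<in> leY E" "(eX E p, c) \<in> Rel E" for a p c
    using coh sub that unfolding two_coherent_def C6_def by blast
  have subYX: "ZYX E \<subseteq> Yc E \<times> Xc E"
    by (auto simp: ZYX_def)
  have ZYX_I: "(y, x) \<in> ZYX E" if "p \<in> Pc E" "q \<in> Pc E" "(y, eY E p) \<in> leY E"
      "(eX E p, eY E q) \<in> Rel E" "(eX E q, x) \<in> leX E" for y x p q
    using that sub unfolding ZYX_def by blast
  have ZYX_E: "\<exists>p\<in>Pc E. \<exists>q\<in>Pc E. (y, eY E p) \<in> leY E \<and> (eX E p, eY E q) \<in> Rel E \<and>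
      (eX E q, x) \<in> leX E" if "(y, x) \<in> ZYX E" for y x
    using that unfolding ZYX_def by blast
  \<comment> \<open>The names record which of X and Y contain \<open>a\<close>, \<open>b\<close> and
    \<open>c\<close>. The first two facts extend an end of a \<open>ZYX\<close> chain by
    transitivity of the order there.\<close>
  have YYX: "(a, c) \<in> ZYX E" if "(a, b) \<in> leY E" "(b, c) \<in> ZYX E" for a b c
    using ZYX_E[OF that(2)] that(1) by (meson ZYX_I tY)
  have YXX: "(a, c) \<in> ZYX E" if "(a, b) \<in> ZYX E" "(b, c) \<in> leX E" for a b c
    using ZYX_E[OF that(1)] that(2) by (meson ZYX_I tX)
  \<comment> \<open>With witnesses \<open>p\<close> and \<open>q\<close>, (C1) gives
    \<open>(eX E q, c) \<in> Rel E\<close>, (C4) gives \<open>(eX E p, c) \<in> Rel E\<close>, and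
    (C6) finishes. The next fact is dual, by (C2), (C4) and (C5).\<close>
  have YXY: "(a, c) \<in> leY E" if "(a, b) \<in> ZYX E" "(b, c) \<in> Rel E" for a b c
    using ZYX_E[OF that(1)] that(2) by (meson c1 c4 c6)
  have XYX: "(a, c) \<in> leX E" if "(a, b) \<in> Rel E" "(b, c) \<in> ZYX E" for a b c
    using ZYX_E[OF that(2)] that(1) by (meson c2 c4 c5)
  have prec1: "prec1 E = Rel E \<union> leX E \<union> leY E \<union> ZYX E"
    using ZX_ZY_eq[OF coh] by (simp add: prec1_def)
  have sub1: "prec1 E \<subseteq> (Xc E \<union> Yc E) \<times> (Xc E \<union> Yc E)"
    unfolding prec1 using sub subYX by blast
  have inter: "prec1 E \<inter> Xc E \<times> Yc E = Rel E" "prec1 E \<inter> Xc E \<times> Xc E = leX E"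
    "prec1 E \<inter> Yc E \<times> Yc E = leY E"
    unfolding prec1 using sub subYX disj by blast+
  have "trans (prec1 E)"
  proof (rule transI)
    fix a b c
    assume "(a, b) \<in> prec1 E" "(b, c) \<in> prec1 E"
    \<comment> \<open>As X and Y are disjoint, the four parts of \<open>prec1 E\<close> lie on four
      disjoint products, so placing \<open>a\<close>, \<open>b\<close> and \<open>c\<close> in X or
      Y determines the parts involved: eight cases.\<close>
    then consider "(a, b) \<in> leX E" "(b, c) \<in> leX E" | "(a, b) \<in> leX E" "(b, c) \<in> Rel E"
      | "(a, b) \<in> Rel E" "(b, c) \<in> ZYX E" | "(a, b) \<in> Rel E" "(b, c) \<in> leY E"
      | "(a, b) \<in> ZYX E" "(b, c) \<in> leX E" | "(a, b) \<in> ZYX E" "(b, c) \<in> Rel E"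
      | "(a, b) \<in> leY E" "(b, c) \<in> ZYX E" | "(a, b) \<in> leY E" "(b, c) \<in> leY E"
      unfolding prec1 using sub subYX disj by blast
    then show "(a, c) \<in> prec1 E"
      unfolding prec1 by cases (blast intro: tX tY c1 c2 YYX YXX YXY XYX)+
  qed
  moreover have "refl_on (Xc E \<union> Yc E) (prec1 E)"
    using rX rY sub1 by (auto simp: refl_on_def prec1)
  ultimately have "preorder_on (Xc E \<union> Yc E) (prec1 E)"
    using sub1 by (simp add: preorder_on_def)
  \<comment> \<open>The pair from \<open>eY E p\<close> to \<open>eX E p\<close> is in
    \<open>ZYX E\<close> with both witnesses equal to \<open>p\<close>: reflexivity at the two ends
    and (C3) in the middle.\<close>
  moreover have "(eX E p, eY E p) \<in> prec1 E" "(eY E p, eX E p) \<in> prec1 E" if "p \<in> Pc E" for p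
    using that c3 ZYX_I[OF that that rY c3 rX] e by (auto simp: prec1)
  ultimately show ?thesis
    using inter by (simp add: two_preorder_iff[OF E])
qed

theorem theorem3p14:
  fixes E :: "('p, 'a) polarity"
  assumes "extension_polarity E"
  shows "(two_coherent E \<longleftrightarrow> two_preorder E (prec1 E)) \<and>
         (two_preorder E (prec1 E) \<longleftrightarrow> (\<exists>r. two_preorder E r)) \<and>
         (\<forall>S. S \<noteq> {} \<and> S \<subseteq> {r. two_preorder E r} \<longrightarrow> \<Inter>S \<in> {r. two_preorder E r}) \<and>
         ({r. two_preorder E r} \<noteq> {} \<longrightarrow>
            prec1 E \<in> {r. two_preorder E r} \<and>
            (\<forall>r\<in>{r. two_preorder E r}. prec1 E \<subseteq> r) \<and>
            leX E = ZX E \<and> leY E = ZY E)"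
proof (intro conjI)
  note coh = two_coherent_if_two_preorder[OF assms]
  note prec1 = two_preorder_prec1[OF assms]
  show "two_coherent E \<longleftrightarrow> two_preorder E (prec1 E)"
    using coh prec1 by (rule iffI[rotated])
  show "two_preorder E (prec1 E) \<longleftrightarrow> (\<exists>r. two_preorder E r)"
    by (auto dest: coh intro: prec1)
  show "\<forall>S. S \<noteq> {} \<and> S \<subseteq> {r. two_preorder E r} \<longrightarrow> \<Inter>S \<in> {r. two_preorder E r}"
    by (auto intro!: two_preorder_Inter[OF assms])
  show "{r. two_preorder E r} \<noteq> {} \<longrightarrow>
      prec1 E \<in> {r. two_preorder E r} \<and>
      (\<forall>r\<in>{r. two_preorder E r}. prec1 E \<subseteq> r) \<and>
      leX E = ZX E \<and> leY E = ZY E"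
  proof
    assume "{r. two_preorder E r} \<noteq> {}"
    \<comment> \<open>Any 2-preorder at all forces coherence, and coherence makes
      \<open>prec1 E\<close> a 2-preorder and collapses \<open>ZX E\<close> and
      \<open>ZY E\<close>.\<close>
    then have "two_coherent E"
      using coh by auto
    then show "prec1 E \<in> {r. two_preorder E r} \<and>
        (\<forall>r\<in>{r. two_preorder E r}. prec1 E \<subseteq> r) \<and> leX E = ZX E \<and> leY E = ZY E"
      using prec1 prec1_least[OF assms] by (simp add: ZX_ZY_eq)
  qed
qed

end
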